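(* Let $S^\star_{2n+2}$ be the double star consisting of two stars $S_1,S_2$, each with a centre ($c_1$, $c_2$ respectively) and $n$ leaves, with the centres joined by the edge $c_1c_2$. For the push discordant voting process started from the configuration in which every vertex of $S_1$ is blue and every vertex of $S_2$ is red, the convergence time (time until all vertices have the same colour) is $\Omega(2^{2n/5})$.
   Context: Push discordant voting: each vertex holds colour red or blue; an edge is discordant if its endpoints have different colours, a vertex is discordant if incident to a discordant edge. At each step choose a discordant vertex $v$ uniformly at random among all discordant vertices and a discordant neighbour $u$ of $v$ uniformly at random; $u$ adopts the colour of $v$, all other colours unchanged. *)

theory Defs
  imports "HOL-Probability.Probability"
begin

section \<open>Path measure of a discrete-time Markov chain\<close>

text \<open>The kernel that draws coordinate \<open>i\<close> of a path from the coordinates before it.\<close>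

definition path_kernel :: "('s \<Rightarrow> 's pmf) \<Rightarrow> 's \<Rightarrow> nat \<Rightarrow> (nat \<Rightarrow> 's) \<Rightarrow> 's measure" where
  "path_kernel K x i \<omega> =
     measure_pmf (case i of 0 \<Rightarrow> return_pmf x | Suc j \<Rightarrow> K (\<omega> j))"

text \<open>The Ionescu-Tulcea measure on infinite paths. It is characterised by
  \<open>prob_space_markov_paths\<close>, \<open>sets_markov_paths\<close> and
  \<open>emeasure_markov_paths_cylinder\<close> below.\<close>

definition markov_paths :: "('s \<Rightarrow> 's pmf) \<Rightarrow> 's \<Rightarrow> (nat \<Rightarrow> 's) measure" where
  "markov_paths K x =
     projective_family.lim UNIV
       (Ionescu_Tulcea.CI (path_kernel K x) (\<lambda>_. count_space UNIV)) (\<lambda>_. count_space UNIV)"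

lemma Ionescu_Tulcea_path_kernel: "Ionescu_Tulcea (path_kernel K x) (\<lambda>_. count_space UNIV)"
proof (rule Ionescu_Tulcea.intro)
  fix i
  have *: "(\<lambda>y. measure_pmf (K y)) \<in> measurable (count_space UNIV) (subprob_algebra (count_space UNIV))"
    for K :: "'a \<Rightarrow> 'a pmf"
    by (auto simp: space_subprob_algebra intro: prob_space_imp_subprob_space measure_pmf.prob_space_axioms)
  show "path_kernel K x i \<in>
          measurable (PiM {0..<i} (\<lambda>_. count_space UNIV)) (subprob_algebra (count_space UNIV))"
  proof (cases i)
    case 0
    then show ?thesis
      by (auto simp: path_kernel_def [abs_def] space_subprob_algebra
          intro!: measurable_const prob_space_imp_subprob_space measure_pmf.prob_space_axioms)
  next
    case (Suc j)
    have "(\<lambda>\<omega>. \<omega> j) \<in> measurable (PiM {0..<i} (\<lambda>_. count_space (UNIV :: 'a set))) (count_space UNIV)"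
      using Suc by (intro measurable_component_singleton) auto
    from measurable_compose [OF this *] Suc show ?thesis
      by (simp add: path_kernel_def [abs_def])
  qed
next
  show "prob_space (path_kernel K x i \<omega>)" for i \<omega>
    by (simp add: path_kernel_def measure_pmf.prob_space_axioms)
qed

lemma prob_space_markov_paths: "prob_space (markov_paths K x)"
proof -
  interpret Ionescu_Tulcea "path_kernel K x" "\<lambda>_. count_space UNIV"
    by (rule Ionescu_Tulcea_path_kernel)
  have "emeasure PF.lim (space PF.lim) =
      emeasure PF.lim (PF.emb UNIV {} (space (PiM {} (\<lambda>_. count_space UNIV))))"
    by (rule arg_cong [where f = "emeasure PF.lim"]) (auto simp: prod_emb_def space_PiM)
  also have "\<dots> = emeasure (CI {}) (space (CI {}))"
    by (subst lim) (simp_all add: PF.space_P)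
  also have "\<dots> = 1"
    by (intro prob_space.emeasure_space_1 PF.prob_space_P) auto
  finally have "emeasure PF.lim (space PF.lim) = 1" .
  then show ?thesis
    unfolding markov_paths_def by (rule prob_spaceI)
qed

lemma sets_markov_paths [measurable_cong]:
  "sets (markov_paths K x) = sets (PiM UNIV (\<lambda>_. count_space UNIV))"
proof -
  interpret Ionescu_Tulcea "path_kernel K x" "\<lambda>_. count_space UNIV"
    by (rule Ionescu_Tulcea_path_kernel)
  show ?thesis
    unfolding markov_paths_def by (rule PF.sets_lim)
qed

lemma emeasure_markov_paths_cylinder:
  "emeasure (markov_paths K x) {\<omega>. \<forall>i\<le>n. \<omega> i = f i} =
     ennreal ((if f 0 = x then 1 else 0) * (\<Prod>i<n. pmf (K (f i)) (f (Suc i))))"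
proof -
  interpret Ionescu_Tulcea "path_kernel K x" "\<lambda>_. count_space UNIV"
    by (rule Ionescu_Tulcea_path_kernel)
  have sets_f: "{restrict f {0..<m}} \<in> sets (PiM {0..<m} (\<lambda>_. count_space UNIV))" for m
  proof -
    have "(\<Pi>\<^sub>E i\<in>{0..<m}. {f i}) \<in> sets (PiM {0..<m} (\<lambda>_. count_space UNIV))"
      by (intro sets_PiM_I_finite) auto
    also have "(\<Pi>\<^sub>E i\<in>{0..<m}. {f i}) = (\<Pi>\<^sub>E i\<in>{0..<m}. {restrict f {0..<m} i})"
      by (intro PiE_cong) auto
    also have "\<dots> = {restrict f {0..<m}}"
      by (rule PiE_singleton [OF restrict_extensional])
    finally show ?thesis .
  qed
  have C_eq: "emeasure (C 0 m (\<lambda>_. undefined)) {restrict f {0..<m}} =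
      (\<Prod>i<m. emeasure (path_kernel K x i f) {f i})" for m
  proof (induction m)
    case 0
    then show ?case
      using sets_f [of 0] by (simp add: restrict_def)
  next
    case (Suc m)
    have "emeasure (C 0 (Suc m) (\<lambda>_. undefined)) {restrict f {0..<Suc m}} =
        (\<integral>\<^sup>+\<omega>. emeasure (eP m \<omega>) {restrict f {0..<Suc m}} \<partial>C 0 m (\<lambda>_. undefined))"
      using sets_f [of "Suc m"]
      by (simp, subst emeasure_bind [where N = "PiM {0..<Suc m} (\<lambda>_. count_space UNIV)"])
        (auto simp: space_C space_PiM measurable_cong_sets [OF sets_C refl] intro!: measurable_eP)
    also have "\<dots> = (\<integral>\<^sup>+\<omega>. emeasure (path_kernel K x m f) {f m} *
        indicator {restrict f {0..<m}} \<omega> \<partial>C 0 m (\<lambda>_. undefined))"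
    proof (rule nn_integral_cong)
      fix \<omega> assume "\<omega> \<in> space (C 0 m (\<lambda>_. undefined))"
      then have \<omega>: "\<omega> \<in> space (PiM {0..<m} (\<lambda>_. count_space UNIV))"
        by (simp add: space_C space_PiM)
      then have ext: "\<omega> \<in> extensional {0..<m}"
        by (auto simp: space_PiM PiE_def)
      have "emeasure (eP m \<omega>) {restrict f {0..<Suc m}} =
          emeasure (path_kernel K x m \<omega>) {y. fun_upd \<omega> m y = restrict f {0..<Suc m}}"
        using emeasure_eP [OF \<omega> sets_f] by (simp add: vimage_def)
      also have "{y. fun_upd \<omega> m y = restrict f {0..<Suc m}} =
          (if \<omega> = restrict f {0..<m} then {f m} else {})"
      proof -
        have "fun_upd \<omega> m y = restrict f {0..<Suc m} \<longleftrightarrow> \<omega> = restrict f {0..<m} \<and> y = f m" for y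
        proof
          assume eq: "fun_upd \<omega> m y = restrict f {0..<Suc m}"
          have "\<omega> i = restrict f {0..<m} i" for i
            using fun_cong [OF eq, of i] ext
            by (cases "i < m"; cases "i = m") (auto simp: extensional_def)
          with fun_cong [OF eq, of m] show "\<omega> = restrict f {0..<m} \<and> y = f m"
            by auto
        next
          assume "\<omega> = restrict f {0..<m} \<and> y = f m"
          then show "fun_upd \<omega> m y = restrict f {0..<Suc m}"
            by (auto simp: fun_eq_iff)
        qed
        then show ?thesis
          by auto
      qed
      also have "emeasure (path_kernel K x m \<omega>) (if \<omega> = restrict f {0..<m} then {f m} else {}) =
          emeasure (path_kernel K x m f) {f m} * indicator {restrict f {0..<m}} \<omega>"
        by (auto simp: path_kernel_def split: nat.split)
      finally show "emeasure (eP m \<omega>) {restrict f {0..<Suc m}} =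
          emeasure (path_kernel K x m f) {f m} * indicator {restrict f {0..<m}} \<omega>" .
    qed
    also have "\<dots> = emeasure (path_kernel K x m f) {f m} *
        emeasure (C 0 m (\<lambda>_. undefined)) {restrict f {0..<m}}"
      using sets_f [of m]
      by (subst nn_integral_cmult_indicator) (auto simp: sets_C space_PiM)
    finally show ?case
      by (simp only: Suc.IH prod.lessThan_Suc mult.commute)
  qed
  have "{\<omega>. \<forall>i\<le>n. \<omega> i = f i} = PF.emb UNIV {0..<Suc n} {restrict f {0..<Suc n}}"
    by (force simp: prod_emb_def space_PiM restrict_def fun_eq_iff less_Suc_eq_le split: if_splits)
  then have "emeasure (markov_paths K x) {\<omega>. \<forall>i\<le>n. \<omega> i = f i} =
      emeasure (CI {0..<Suc n}) {restrict f {0..<Suc n}}"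
    unfolding markov_paths_def using lim [OF _ sets_f] by simp
  also have "\<dots> = emeasure (C 0 (Suc n) (\<lambda>_. undefined)) {restrict f {0..<Suc n}}"
    using emeasure_CI [OF subset_refl sets_f] sets.sets_into_space [OF sets_f, unfolded space_PiM]
    by (simp only: prod_emb_id)
  also have "\<dots> = (\<Prod>i<Suc n. emeasure (path_kernel K x i f) {f i})"
    by (rule C_eq)
  also have "\<dots> = emeasure (return_pmf x) {f 0} * (\<Prod>i<n. emeasure (K (f i)) {f (Suc i)})"
    by (subst prod.lessThan_Suc_shift) (simp add: path_kernel_def)
  also have "\<dots> = ennreal ((if f 0 = x then 1 else 0) * (\<Prod>i<n. pmf (K (f i)) (f (Suc i))))"
    by (simp add: emeasure_pmf_single prod_ennreal ennreal_mult')
  finally show ?thesis .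
qed


section \<open>Push discordant voting\<close>

datatype colour = Red | Blue

text \<open>A graph is given by its vertex set \<open>V\<close> and its set \<open>E\<close> of two-element edges; colours of
  elements outside \<open>V\<close> play no role.\<close>

type_synonym 'v colouring = "'v \<Rightarrow> colour"

definition discordant_edges :: "'v set set \<Rightarrow> 'v colouring \<Rightarrow> 'v set set" where
  "discordant_edges E \<sigma> = {{u, v} | u v. {u, v} \<in> E \<and> \<sigma> u \<noteq> \<sigma> v}"

definition discordant_vertices :: "'v set set \<Rightarrow> 'v colouring \<Rightarrow> 'v set" where
  "discordant_vertices E \<sigma> = {v. \<exists>e \<in> discordant_edges E \<sigma>. v \<in> e}"

definition discordant_neighbours :: "'v set set \<Rightarrow> 'v colouring \<Rightarrow> 'v \<Rightarrow> 'v set" where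
  "discordant_neighbours E \<sigma> v = {u. {u, v} \<in> discordant_edges E \<sigma>}"

text \<open>A colouring without discordant vertices is absorbing.\<close>

definition push_step :: "'v set set \<Rightarrow> 'v colouring \<Rightarrow> 'v colouring pmf" where
  "push_step E \<sigma> =
     (if discordant_vertices E \<sigma> = {} then return_pmf \<sigma>
      else do {
        v \<leftarrow> pmf_of_set (discordant_vertices E \<sigma>);
        u \<leftarrow> pmf_of_set (discordant_neighbours E \<sigma> v);
        return_pmf (\<sigma>(u := \<sigma> v))
      })"

definition monochromatic :: "'v set \<Rightarrow> 'v colouring \<Rightarrow> bool" where
  "monochromatic V \<sigma> \<longleftrightarrow> (\<exists>c. \<forall>v\<in>V. \<sigma> v = c)"

text \<open>The value is \<open>\<infinity>\<close> (the infimum of the empty set) on paths that never reach consensus.\<close>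

definition convergence_time :: "'v set \<Rightarrow> (nat \<Rightarrow> 'v colouring) \<Rightarrow> enat" where
  "convergence_time V \<omega> = Inf {enat t | t. monochromatic V (\<omega> t)}"

lemma measurable_convergence_time:
  "(\<lambda>\<omega>. ennreal_of_enat (convergence_time V \<omega>)) \<in> borel_measurable (markov_paths K \<sigma>)"
proof -
  have 1: "Measurable.pred (PiM UNIV (\<lambda>_. count_space UNIV)) (\<lambda>\<omega>. P (\<omega> t))"
    for P :: "'a colouring \<Rightarrow> bool" and t :: nat
    by (rule measurable_compose [OF measurable_component_singleton]) auto
  have eq: "convergence_time V \<omega> =
      (INF t. if monochromatic V (\<omega> t) then enat t else \<infinity>)" for \<omega>
    unfolding convergence_time_def
    by (intro antisym INF_greatest Inf_greatest) (auto intro: Inf_lower INF_lower2)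
  have "(\<lambda>\<omega>. convergence_time V \<omega>) \<in>
      measurable (PiM UNIV (\<lambda>_. count_space UNIV)) (count_space UNIV)"
    unfolding eq by (intro measurable_INF measurable_If 1 [unfolded pred_def]) auto
  then show ?thesis
    by (subst measurable_cong_sets [OF sets_markov_paths refl]) simp
qed

definition expected_convergence_time ::
    "'v set \<Rightarrow> 'v set set \<Rightarrow> 'v colouring \<Rightarrow> ennreal" where
  "expected_convergence_time V E \<sigma> =
     (\<integral>\<^sup>+\<omega>. ennreal_of_enat (convergence_time V \<omega>) \<partial>markov_paths (push_step E) \<sigma>)"


section \<open>The double star\<close>

datatype star = S1 | S2

datatype vertex = Centre star | Leaf star nat

definition star_vertices :: "nat \<Rightarrow> star \<Rightarrow> vertex set" where
  "star_vertices n s = insert (Centre s) (Leaf s ` {..<n})"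

definition star_edges :: "nat \<Rightarrow> star \<Rightarrow> vertex set set" where
  "star_edges n s = {{Centre s, Leaf s j} | j. j < n}"

definition double_star_vertices :: "nat \<Rightarrow> vertex set" where
  "double_star_vertices n = star_vertices n S1 \<union> star_vertices n S2"

definition double_star_edges :: "nat \<Rightarrow> vertex set set" where
  "double_star_edges n = star_edges n S1 \<union> star_edges n S2 \<union> {{Centre S1, Centre S2}}"

definition initial_colouring :: "nat \<Rightarrow> vertex colouring" where
  "initial_colouring n v = (if v \<in> star_vertices n S1 then Blue else Red)"

end

theory Submission
  imports Defs
begin

text \<open>Call a vertex away if its colour differs from the initial colour of its star. Weighted by
  discordant vertices, the two stars evolve almost independently: with \<open>a\<close> leaves away, a centre
  turns away at rate about \<open>a\<close> and turns back at rate \<open>n - a\<close>, and it then recolours leaves at rate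
  about \<open>1\<close>, so \<open>a\<close> moves up and down in the ratio \<open>a : (n - a)\<close>. As long as \<open>a \<le> n / 5\<close> this ratio
  is at most \<open>1 : 4\<close>, and the potential with leading term \<open>4 ^ a\<close> for each star has drift at most a
  constant. It starts at \<open>2\<close> and is at least \<open>4 ^ (n / 5)\<close>, up to a constant factor, at consensus, so
  consensus takes about that many steps.\<close>

section \<open>Survival of a Markov chain with bounded drift\<close>

text \<open>Survival up to time \<open>t\<close> is encoded by lists of \<open>t + 1\<close> states.
  Following only transitions of positive probability keeps the set finite for kernels with finite
  support, so the path measure enters only through its cylinder formula.\<close>

primrec surviving_paths :: "('s \<Rightarrow> 's pmf) \<Rightarrow> ('s \<Rightarrow> bool) \<Rightarrow> nat \<Rightarrow> 's \<Rightarrow> 's list set" where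
  "surviving_paths K B 0 x = (if B x then {} else {[x]})"
| "surviving_paths K B (Suc t) x =
     (if B x then {} else \<Union>y\<in>set_pmf (K x). (#) x ` surviving_paths K B t y)"

definition path_weight :: "('s \<Rightarrow> 's pmf) \<Rightarrow> nat \<Rightarrow> 's list \<Rightarrow> real" where
  "path_weight K t l = (\<Prod>i<t. pmf (K (l ! i)) (l ! Suc i))"

lemma surviving_paths_imp:
  "l \<in> surviving_paths K B t x \<Longrightarrow> length l = Suc t \<and> l ! 0 = x \<and> (\<forall>i\<le>t. \<not> B (l ! i))"
proof (induction t arbitrary: l x)
  case 0
  then show ?case by (auto split: if_splits)
next
  case (Suc t)
  then obtain y l' where l: "l = x # l'" "\<not> B x" and l': "l' \<in> surviving_paths K B t y"
    by (auto split: if_splits)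
  from Suc.IH [OF l'] l show ?case
    by (auto simp: nth_Cons split: nat.split)
qed

lemma surviving_pathsD:
  assumes "l \<in> surviving_paths K B t x"
  shows "length l = Suc t" and "l ! 0 = x" and "i \<le> t \<Longrightarrow> \<not> B (l ! i)"
  using surviving_paths_imp [OF assms] by auto

lemma finite_surviving_paths:
  assumes "\<And>x. finite (set_pmf (K x))"
  shows "finite (surviving_paths K B t x)"
  using assms by (induction t arbitrary: x) auto

text \<open>First-step decomposition: the second state of a path reveals \<open>y\<close>, so the
  images for distinct \<open>y\<close> are disjoint, and the transition to \<open>y\<close> is the
  first factor of the weight.\<close>

lemma sum_path_weight_Suc:
  assumes fin: "\<And>x. finite (set_pmf (K x))" and "\<not> B x"
  shows "(\<Sum>l\<in>surviving_paths K B (Suc t) x. path_weight K (Suc t) l) =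
    (\<Sum>y\<in>set_pmf (K x). pmf (K x) y * (\<Sum>l\<in>surviving_paths K B t y. path_weight K t l))"
proof -
  have disj: "(#) x ` surviving_paths K B t y \<inter> (#) x ` surviving_paths K B t z = {}"
    if "y \<noteq> z" for y z
    using that by (auto dest: surviving_pathsD(2))
  have "(\<Sum>l\<in>surviving_paths K B (Suc t) x. path_weight K (Suc t) l) =
      (\<Sum>y\<in>set_pmf (K x). \<Sum>l\<in>(#) x ` surviving_paths K B t y. path_weight K (Suc t) l)"
    using assms disj finite_surviving_paths [OF fin]
    by (simp, subst sum.UNION_disjoint) auto
  also have "\<dots> = (\<Sum>y\<in>set_pmf (K x). \<Sum>l\<in>surviving_paths K B t y. pmf (K x) y * path_weight K t l)"
  proof (rule sum.cong [OF refl])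
    fix y
    show "(\<Sum>l\<in>(#) x ` surviving_paths K B t y. path_weight K (Suc t) l) =
        (\<Sum>l\<in>surviving_paths K B t y. pmf (K x) y * path_weight K t l)"
      by (subst sum.reindex)
        (auto simp: path_weight_def prod.lessThan_Suc_shift surviving_pathsD(2) simp del: prod.lessThan_Suc
          intro!: sum.cong)
  qed
  finally show ?thesis
    by (simp add: sum_distrib_left)
qed

text \<open>Where \<open>\<phi>\<close> reaches \<open>M\<close> the bound is trivial, so the drift condition is needed only below \<open>M\<close>;
  backward induction on the remaining time also avoids any appeal to the target being absorbing.\<close>

lemma sum_path_weight_ge:
  fixes \<phi> :: "'s \<Rightarrow> real"
  assumes fin: "\<And>x. finite (set_pmf (K x))"
    and "M > 0" "C \<ge> 0"
    and nonneg_\<phi>: "\<And>x. \<phi> x \<ge> 0"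
    and target: "\<And>x. B x \<Longrightarrow> \<phi> x \<ge> M"
    and drift: "\<And>x. \<not> B x \<Longrightarrow> \<phi> x < M \<Longrightarrow> measure_pmf.expectation (K x) \<phi> \<le> \<phi> x + C"
  shows "(\<Sum>l\<in>surviving_paths K B t x. path_weight K t l) \<ge> 1 - (\<phi> x + C * t) / M"
proof (induction t arbitrary: x)
  have nonneg: "(\<Sum>l\<in>surviving_paths K B t x. path_weight K t l) \<ge> 0" for t x
    by (auto simp: path_weight_def intro!: sum_nonneg prod_nonneg)
  have trivial: "(\<Sum>l\<in>surviving_paths K B t x. path_weight K t l) \<ge> 1 - (\<phi> x + C * t) / M"
    if "\<phi> x \<ge> M" for t x
  proof -
    have "M \<le> \<phi> x + C * t" using that \<open>C \<ge> 0\<close> by (simp add: add_increasing2)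
    then have "1 - (\<phi> x + C * t) / M \<le> 0" using \<open>M > 0\<close> by simp
    with nonneg show ?thesis by (rule order_trans[rotated])
  qed
  {
    case 0
    show ?case
    proof (cases "\<phi> x \<ge> M")
      case True
      with trivial show ?thesis by blast
    next
      case False
      then have "\<not> B x" using target by blast
      then show ?thesis using nonneg_\<phi> [of x] \<open>M > 0\<close> by (simp add: path_weight_def)
    qed
  next
    case (Suc t)
    show ?case
    proof (cases "\<phi> x \<ge> M")
      case True
      with trivial show ?thesis by blast
    next
      case False
      then have "\<not> B x" using target by blast
      have "1 - (\<phi> x + C * Suc t) / M \<le> 1 - (measure_pmf.expectation (K x) \<phi> + C * t) / M"
        using drift [OF \<open>\<not> B x\<close>] False \<open>M > 0\<close>
        by (intro diff_left_mono divide_right_mono) (auto simp: algebra_simps)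
      \<comment> \<open>The bound is affine in \<open>\<phi>\<close> and the transition
        probabilities sum to 1, so it averages over the next state, where the induction hypothesis
        applies.\<close>
      also have "\<dots> = (\<Sum>y\<in>set_pmf (K x). pmf (K x) y * (1 - (\<phi> y + C * t) / M))"
      proof -
        have "(\<Sum>y\<in>set_pmf (K x). pmf (K x) y * (1 - (\<phi> y + C * t) / M)) =
            (\<Sum>y\<in>set_pmf (K x). pmf (K x) y) * (1 - C * t / M) -
            (\<Sum>y\<in>set_pmf (K x). pmf (K x) y * \<phi> y) / M"
          unfolding sum_distrib_right sum_divide_distrib sum_subtractf [symmetric]
          by (intro sum.cong refl) (simp add: algebra_simps add_divide_distrib)
        moreover have "(\<Sum>y\<in>set_pmf (K x). pmf (K x) y) = 1"
          by (rule sum_pmf_eq_1 [OF fin]) simp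
        moreover have "measure_pmf.expectation (K x) \<phi> = (\<Sum>y\<in>set_pmf (K x). pmf (K x) y * \<phi> y)"
          by (subst integral_measure_pmf [OF fin]) auto
        ultimately show ?thesis by (simp add: add_divide_distrib)
      qed
      also have "\<dots> \<le> (\<Sum>y\<in>set_pmf (K x).
          pmf (K x) y * (\<Sum>l\<in>surviving_paths K B t y. path_weight K t l))"
        by (intro sum_mono mult_left_mono Suc.IH) auto
      also have "\<dots> = (\<Sum>l\<in>surviving_paths K B (Suc t) x. path_weight K (Suc t) l)"
        using sum_path_weight_Suc [of K B x t] fin \<open>\<not> B x\<close> by simp
      finally show ?thesis .
    qed
  }
qed

section \<open>From weights of finite paths to the path measure\<close>

lemma sets_markov_paths_Collect:
  "{\<omega>. \<forall>i\<le>t. P i (\<omega> i)} \<in> sets (markov_paths K x)"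
proof -
  have "Measurable.pred (PiM UNIV (\<lambda>_. count_space UNIV)) (\<lambda>\<omega>. \<forall>i\<in>{..t}. P i (\<omega> i))"
    by (intro pred_intros_finite measurable_compose [OF measurable_component_singleton]) auto
  then show ?thesis
    by (simp add: sets_markov_paths pred_def space_PiM Ball_def)
qed

text \<open>The survival event contains the cylinders of all surviving paths, and distinct lists of
  equal length have disjoint cylinders, so the weights add up to a lower bound.\<close>

lemma emeasure_survival_ge:
  assumes fin: "\<And>x. finite (set_pmf (K x))"
  shows "emeasure (markov_paths K x) {\<omega>. \<forall>i\<le>t. \<not> B (\<omega> i)} \<ge>
    ennreal (\<Sum>l\<in>surviving_paths K B t x. path_weight K t l)"
proof -
  let ?S = "surviving_paths K B t x" and ?cyl = "\<lambda>l. {\<omega>. \<forall>i\<le>t. \<omega> i = l ! i}"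
  have disj: "disjoint_family_on ?cyl ?S"
    unfolding disjoint_family_on_def
  proof (intro ballI impI)
    fix l m assume "l \<in> ?S" "m \<in> ?S" "l \<noteq> m"
    then obtain i where "i \<le> t" "l ! i \<noteq> m ! i"
      using nth_equalityI [of l m] by (auto simp: surviving_pathsD(1) less_Suc_eq_le)
    then show "?cyl l \<inter> ?cyl m = {}" by force
  qed
  have "ennreal (\<Sum>l\<in>?S. path_weight K t l) = (\<Sum>l\<in>?S. ennreal (path_weight K t l))"
    by (auto simp: path_weight_def intro!: sum_ennreal [symmetric] prod_nonneg)
  also have "\<dots> = (\<Sum>l\<in>?S. emeasure (markov_paths K x) (?cyl l))"
  proof (intro sum.cong refl)
    fix l assume "l \<in> ?S"
    then have "l ! 0 = x" by (rule surviving_pathsD(2))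
    then show "ennreal (path_weight K t l) = emeasure (markov_paths K x) (?cyl l)"
      by (subst emeasure_markov_paths_cylinder) (simp add: path_weight_def)
  qed
  also have "\<dots> = emeasure (markov_paths K x) (\<Union>l\<in>?S. ?cyl l)"
    by (rule sum_emeasure [OF _ disj finite_surviving_paths [OF fin]])
      (use sets_markov_paths_Collect [where P = "\<lambda>i y. y = _ ! i"] in auto)
  also have "\<dots> \<le> emeasure (markov_paths K x) {\<omega>. \<forall>i\<le>t. \<not> B (\<omega> i)}"
    by (intro emeasure_mono sets_markov_paths_Collect) (auto dest: surviving_pathsD(3))
  finally show ?thesis .
qed

text \<open>Markov's inequality: a path without consensus up to \<open>t\<close> has convergence
  time beyond \<open>t\<close>, possibly infinite.\<close>

lemma expected_convergence_time_ge_survival: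
  "expected_convergence_time V E \<sigma> \<ge>
    of_nat t * emeasure (markov_paths (push_step E) \<sigma>) {\<omega>. \<forall>i\<le>t. \<not> monochromatic V (\<omega> i)}"
proof -
  let ?A = "{\<omega>. \<forall>i\<le>t. \<not> monochromatic V (\<omega> i)}" and ?M = "markov_paths (push_step E) \<sigma>"
  have "of_nat t * emeasure ?M ?A = (\<integral>\<^sup>+\<omega>. of_nat t * indicator ?A \<omega> \<partial>?M)"
    by (rule nn_integral_cmult_indicator [symmetric])
      (rule sets_markov_paths_Collect [where P = "\<lambda>i y. \<not> monochromatic V y"])
  also have "\<dots> \<le> expected_convergence_time V E \<sigma>"
    unfolding expected_convergence_time_def
  proof (rule nn_integral_mono)
    fix \<omega>
    have "ennreal_of_enat (enat t) \<le> ennreal_of_enat (convergence_time V \<omega>)" if "\<omega> \<in> ?A"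
      using that unfolding convergence_time_def ennreal_of_enat_le_iff
      by (intro Inf_greatest) (auto intro: nat_le_linear [THEN disjE])
    then show "of_nat t * indicator ?A \<omega> \<le> ennreal_of_enat (convergence_time V \<omega>)"
      by (auto simp: indicator_def)
  qed
  finally show ?thesis .
qed

section \<open>Drift of push voting\<close>

text \<open>For concordant vertices the quotient is \<open>0 / 0 = 0\<close>, so that a sum of drifts over discordant
  vertices may be extended to all vertices.\<close>

definition push_drift :: "'v set set \<Rightarrow> 'v colouring \<Rightarrow> ('v colouring \<Rightarrow> real) \<Rightarrow> 'v \<Rightarrow> real" where
  "push_drift E \<sigma> F v =
     (\<Sum>u\<in>discordant_neighbours E \<sigma> v. F (\<sigma>(u := \<sigma> v)) - F \<sigma>) / card (discordant_neighbours E \<sigma> v)"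

lemma discordant_neighbours_eq:
  "discordant_neighbours E \<sigma> v = {u. {u, v} \<in> E \<and> \<sigma> u \<noteq> \<sigma> v}"
  by (auto simp: discordant_neighbours_def discordant_edges_def doubleton_eq_iff insert_commute)

lemma discordant_vertices_iff:
  "v \<in> discordant_vertices E \<sigma> \<longleftrightarrow> discordant_neighbours E \<sigma> v \<noteq> {}"
  unfolding discordant_neighbours_eq
  by (auto simp: discordant_vertices_def discordant_edges_def insert_commute) metis+

lemma discordant_subset_Union:
  "discordant_vertices E \<sigma> \<subseteq> \<Union>E" "discordant_neighbours E \<sigma> v \<subseteq> \<Union>E"
  by (auto simp: discordant_vertices_def discordant_edges_def discordant_neighbours_eq)

lemma finite_set_pmf_push_step:
  assumes "finite (\<Union>E)"
  shows "finite (set_pmf (push_step E \<sigma>))"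
proof -
  have "finite (discordant_vertices E \<sigma>)" "finite (discordant_neighbours E \<sigma> v)" for v
    using discordant_subset_Union assms by (metis finite_subset)+
  then show ?thesis
    by (auto simp: push_step_def discordant_vertices_iff)
qed

text \<open>Total expectation over the two uniform choices. Keeping the sum over discordant vertices
  apart from their number allows the sum to be bounded star by star.\<close>

lemma expectation_push_step:
  assumes fin: "finite (\<Union>E)" and ne: "discordant_vertices E \<sigma> \<noteq> {}"
  shows "measure_pmf.expectation (push_step E \<sigma>) F =
    F \<sigma> + (\<Sum>v\<in>discordant_vertices E \<sigma>. push_drift E \<sigma> F v) / card (discordant_vertices E \<sigma>)"
proof -
  let ?D = "discordant_vertices E \<sigma>" and ?N = "discordant_neighbours E \<sigma>"
  have finD: "finite ?D" and finN: "finite (?N v)" for v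
    using discordant_subset_Union fin by (metis finite_subset)+
  have inner: "measure_pmf.expectation (pmf_of_set (?N v) \<bind> (\<lambda>u. return_pmf (\<sigma>(u := \<sigma> v)))) F =
      F \<sigma> + push_drift E \<sigma> F v" if "v \<in> ?D" for v
  proof -
    have nev: "?N v \<noteq> {}" using that by (simp add: discordant_vertices_iff)
    have "measure_pmf.expectation (pmf_of_set (?N v) \<bind> (\<lambda>u. return_pmf (\<sigma>(u := \<sigma> v)))) F =
        (\<Sum>u\<in>?N v. F (\<sigma>(u := \<sigma> v)) / card (?N v))"
      by (subst pmf_expectation_bind_pmf_of_set [OF nev finN]) (auto simp: field_simps)
    then show ?thesis
      using nev finN by (simp add: push_drift_def sum_subtractf sum_divide_distrib [symmetric] diff_divide_distrib)
  qed
  have "measure_pmf.expectation (push_step E \<sigma>) F =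
      (\<Sum>v\<in>?D. measure_pmf.expectation
        (pmf_of_set (?N v) \<bind> (\<lambda>u. return_pmf (\<sigma>(u := \<sigma> v)))) F / card ?D)"
    using ne finD finN unfolding push_step_def
    by (simp, subst pmf_expectation_bind_pmf_of_set) (auto simp: discordant_vertices_iff field_simps)
  also have "\<dots> = (\<Sum>v\<in>?D. (F \<sigma> + push_drift E \<sigma> F v) / card ?D)"
    using inner by simp
  finally show ?thesis
    using ne finD by (simp add: sum_divide_distrib [symmetric] sum.distrib add_divide_distrib)
qed

lemma push_drift_add:
  "push_drift E \<sigma> (\<lambda>\<tau>. F \<tau> + G \<tau>) v = push_drift E \<sigma> F v + push_drift E \<sigma> G v"
  unfolding push_drift_def add_divide_distrib [symmetric] sum.distrib [symmetric]
  by (simp add: algebra_simps)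

section \<open>The potential of a star\<close>

fun other :: "star \<Rightarrow> star" where
  "other S1 = S2"
| "other S2 = S1"

lemma other_neq [simp]: "other s \<noteq> s" "s \<noteq> other s"
  by (cases s; simp)+

fun home :: "star \<Rightarrow> colour" where
  "home S1 = Blue"
| "home S2 = Red"

definition away :: "nat \<Rightarrow> star \<Rightarrow> vertex colouring \<Rightarrow> nat" where
  "away n s \<sigma> = card {j. j < n \<and> \<sigma> (Leaf s j) \<noteq> home s}"

text \<open>The extra weight of an away centre is chosen so that the loss \<open>3 * 4 ^ (a - 1) * a / (a + 1)\<close>
  in a home state, where the centre recolours a leaf, pays for the centre turning away, which happens
  at rate at most \<open>a + 1\<close>: \<open>a\<close> from its leaves and \<open>1\<close> from the other centre.\<close>

definition star_weight :: "bool \<Rightarrow> nat \<Rightarrow> real" where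
  "star_weight b a = 4 ^ a + (if b then 3 / 4 * 4 ^ a / (a + 3) else 0)"

definition star_potential :: "nat \<Rightarrow> star \<Rightarrow> vertex colouring \<Rightarrow> real" where
  "star_potential n s \<sigma> = star_weight (\<sigma> (Centre s) \<noteq> home s) (away n s \<sigma>)"

text \<open>\<open>m\<close> tells whether the centres are discordant, \<open>k\<close> and \<open>k'\<close> count the discordant leaves of
  this star and of the other one. The three summands come from the leaves of the star, from its centre,
  and from the other centre.\<close>

lemma star_weight_drift:
  assumes k: "k = (if b then n - a else a)" and "m \<le> 1" and a: "b \<Longrightarrow> 5 * a + 16 \<le> n"
  shows "real k * (star_weight (\<not> b) a - star_weight b a)
    + real k * (star_weight b (if b then a + 1 else a - 1) - star_weight b a) / real (k + m)
    + real m * (star_weight (\<not> b) a - star_weight b a) / real (k' + m) \<le> 1 / 4"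
proof -
  \<comment> \<open>Once chosen, the other centre recolours this one with probability
    \<open>m / (k' + m)\<close>; for \<open>m = 0\<close> this is 0, also when
    \<open>k' = 0\<close>.\<close>
  have m: "real m / real (k' + m) \<le> 1" "0 \<le> real m / real (k' + m)"
    by (cases "m = 0"; simp add: field_simps)+
  define e :: real where "e = 3 / 4 * 4 ^ a / (a + 3)"
  have e: "e \<ge> 0" by (simp add: e_def)
  show ?thesis
  proof (cases b)
    case False
    have *: "real m * e / real (k' + m) \<le> e"
      using mult_left_mono [OF m(1) e] by (simp add: mult.commute)
    show ?thesis
    proof (cases a)
      \<comment> \<open>With the centre home and no leaf away, only the other centre can act on this
        star. The bound \<open>1 / 4\<close> is the value of \<open>e\<close> at
        \<open>a = 0\<close>.\<close>
      case 0
      then show ?thesis using False k * by (simp add: star_weight_def e_def)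
    next
      case (Suc i)
      define q :: real where "q = 4 ^ i"
      have "q > 0" by (simp add: q_def)
      \<comment> \<open>The expected loss \<open>3 * q * a / (a + m)\<close> from recolouring a leaf
        must cover \<open>(a + 1) * e\<close>, which is \<open>3 * q * (a + 1) / (a + 3)\<close>.
        Since \<open>m \<le> 1\<close>, this reduces to the present inequality, true for
        \<open>a \<ge> 1\<close>.\<close>
      have "(a + 1) * (a + 1) \<le> a * (a + 3)" using Suc by (simp add: algebra_simps)
      then have "(real a + 1) / (real a + 3) \<le> a / (real a + 1)"
        by (simp add: divide_simps) (simp add: algebra_simps flip: of_nat_mult of_nat_add)
      also have "\<dots> \<le> a / real (a + m)"
        using \<open>m \<le> 1\<close> Suc by (intro divide_left_mono) auto
      finally have "3 * q * ((real a + 1) / (real a + 3)) \<le> 3 * q * (a / real (a + m))"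
        using \<open>q > 0\<close> by (intro mult_left_mono) auto
      moreover have "e = 3 * q / (real a + 3)" by (simp add: e_def q_def Suc)
      ultimately have "a * e + e \<le> 3 * q * (a / real (a + m))"
        by (simp add: add_divide_distrib [symmetric] algebra_simps)
      moreover have "star_weight b (a - 1) - star_weight b a = - 3 * q"
        using False by (simp add: star_weight_def q_def Suc)
      moreover have "star_weight (\<not> b) a - star_weight b a = e"
        using False by (simp add: star_weight_def e_def)
      moreover have "real a * (- 3 * q) / real (a + m) = - (3 * q * (a / real (a + m)))"
        by simp
      moreover have "k = a" "(if b then a + 1 else a - 1) = a - 1" using False k by auto
      ultimately show ?thesis using * by (simp only:)
    qed
  next
    case True
    define q :: real where "q = 4 ^ a"
    have "q > 0" by (simp add: q_def)
    \<comment> \<open>The home leaves turning the centre back lose \<open>k * e\<close> in total.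
      One more away leaf gains at most \<open>(4 * a + 16) * e\<close>, so the loss suffices if
      \<open>4 * a + 16 \<le> n - a\<close>; this is the source of the hypothesis on
      \<open>n\<close>.\<close>
    have k: "k = n - a" and k1: "real k \<ge> 4 * real a + 16" using True k a by auto
    have up: "star_weight b (a + 1) - star_weight b a = 3 * q + 3 * q / (real a + 4) - e"
      using True by (simp add: star_weight_def q_def e_def algebra_simps)
    have "3 * q / (real a + 4) \<le> 3 * q / (real a + 3)" "3 * q / (real a + 3) \<le> q"
      using \<open>q > 0\<close> by (auto simp: field_simps)
    then have "3 * q + 3 * q / (real a + 4) - e \<le> 3 * q + 3 * q / (real a + 3)" using e by linarith
    also have "\<dots> = (4 * real a + 16) * e"
      by (simp add: e_def q_def field_simps)
    also have "\<dots> \<le> k * e" using k1 e by (intro mult_right_mono)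
    finally have B: "star_weight b (a + 1) - star_weight b a \<le> k * e" by (simp only: up)
    have "real k * (star_weight b (a + 1) - star_weight b a) / real (k + m) \<le> real k * e"
    proof -
      \<comment> \<open>Nonnegativity of the gain permits replacing the factor
        \<open>k / (k + m)\<close> by 1.\<close>
      have "star_weight b (a + 1) - star_weight b a \<ge> 0"
      proof -
        have "e \<le> 3 * q" using \<open>q > 0\<close> by (simp add: e_def q_def field_simps)
        moreover have "3 * q / (real a + 4) \<ge> 0" using \<open>q > 0\<close> by simp
        ultimately show ?thesis unfolding up by linarith
      qed
      then have "real k / real (k + m) * (star_weight b (a + 1) - star_weight b a) \<le>
          1 * (star_weight b (a + 1) - star_weight b a)"
        by (intro mult_right_mono) (auto simp: divide_simps)
      also have "\<dots> \<le> k * e" using B by (simp only: mult_1)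
      finally show ?thesis by (simp only: times_divide_eq_left)
    qed
    moreover have "star_weight (\<not> b) a - star_weight b a = - e"
      using True by (simp add: star_weight_def e_def)
    moreover have "real m * e / real (k' + m) \<ge> 0" using e by simp
    moreover have "(if b then a + 1 else a - 1) = a + 1" using True by simp
    ultimately show ?thesis by (simp only: mult_minus_right)
  qed
qed

section \<open>The double star\<close>

lemma edge_Leaf [simp]:
  "{u, Leaf s j} \<in> double_star_edges n \<longleftrightarrow> u = Centre s \<and> j < n"
  by (cases s) (auto simp: double_star_edges_def star_edges_def doubleton_eq_iff)

lemma edge_Centre [simp]:
  "{u, Centre s} \<in> double_star_edges n \<longleftrightarrow> (\<exists>j<n. u = Leaf s j) \<or> u = Centre (other s)"
  by (cases s) (auto simp: double_star_edges_def star_edges_def doubleton_eq_iff)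

lemma Union_double_star_edges: "\<Union>(double_star_edges n) \<subseteq> double_star_vertices n"
  by (auto simp: double_star_edges_def star_edges_def double_star_vertices_def star_vertices_def)

lemma finite_double_star_vertices: "finite (double_star_vertices n)"
  by (simp add: double_star_vertices_def star_vertices_def)

lemma sum_double_star_vertices:
  fixes h :: "vertex \<Rightarrow> real"
  shows "sum h (double_star_vertices n) =
    h (Centre s) + (\<Sum>j<n. h (Leaf s j)) + h (Centre (other s)) + (\<Sum>j<n. h (Leaf (other s) j))"
proof -
  have "sum h (star_vertices n r) = h (Centre r) + (\<Sum>j<n. h (Leaf r j))" for r
    unfolding star_vertices_def by (subst sum.insert) (auto simp: sum.reindex inj_on_def)
  moreover have "double_star_vertices n = star_vertices n s \<union> star_vertices n (other s)"
    by (cases s) (auto simp: double_star_vertices_def)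
  moreover have "star_vertices n s \<inter> star_vertices n (other s) = {}"
    by (auto simp: star_vertices_def)
  moreover have "finite (star_vertices n r)" for r
    by (simp add: star_vertices_def)
  ultimately show ?thesis
    by (simp add: sum.union_disjoint)
qed

section \<open>Effect of single updates on the potential of one star\<close>

lemma discordant_neighbours_Leaf:
  assumes "j < n"
  shows "discordant_neighbours (double_star_edges n) \<sigma> (Leaf s j) =
    (if \<sigma> (Leaf s j) \<noteq> \<sigma> (Centre s) then {Centre s} else {})"
  using assms by (auto simp: discordant_neighbours_eq)

lemma discordant_neighbours_Centre:
  "discordant_neighbours (double_star_edges n) \<sigma> (Centre s) =
    Leaf s ` {j. j < n \<and> \<sigma> (Leaf s j) \<noteq> \<sigma> (Centre s)} \<union>
    (if \<sigma> (Centre (other s)) \<noteq> \<sigma> (Centre s) then {Centre (other s)} else {})"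
  by (auto simp: discordant_neighbours_eq)

lemma colour_cases: "c = d \<or> c = e" if "d \<noteq> e" for c d e :: colour
  using that by (cases c; cases d; cases e) auto

text \<open>With only two colours, a leaf disagrees with an away centre exactly when the leaf is
  home.\<close>

lemma card_discordant_leaves:
  "card {j. j < n \<and> \<sigma> (Leaf s j) \<noteq> \<sigma> (Centre s)} =
    (if \<sigma> (Centre s) \<noteq> home s then n - away n s \<sigma> else away n s \<sigma>)"
proof (cases "\<sigma> (Centre s) = home s")
  case True
  then show ?thesis by (simp add: away_def)
next
  case False
  then have "{j. j < n \<and> \<sigma> (Leaf s j) \<noteq> \<sigma> (Centre s)} = {..<n} - {j. j < n \<and> \<sigma> (Leaf s j) \<noteq> home s}"
    using colour_cases by fastforce
  with False show ?thesis by (simp add: away_def card_Diff_subset subset_iff)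
qed

lemma star_potential_upd_Centre:
  assumes "c \<noteq> \<sigma> (Centre s)"
  shows "star_potential n s (\<sigma>(Centre s := c)) =
    star_weight (\<not> \<sigma> (Centre s) \<noteq> home s) (away n s \<sigma>)"
proof -
  have "c \<noteq> home s \<longleftrightarrow> \<not> \<sigma> (Centre s) \<noteq> home s"
    using assms by (cases c; cases "\<sigma> (Centre s)"; cases "home s") auto
  then show ?thesis by (simp add: star_potential_def away_def)
qed

lemma star_potential_upd_other:
  "star_potential n s (\<sigma>(Centre (other s) := c)) = star_potential n s \<sigma>"
  "star_potential n s (\<sigma>(Leaf (other s) j := c)) = star_potential n s \<sigma>"
  by (simp_all add: star_potential_def away_def)

lemma star_potential_upd_Leaf:
  assumes "j < n" "\<sigma> (Leaf s j) \<noteq> \<sigma> (Centre s)"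
  shows "star_potential n s (\<sigma>(Leaf s j := \<sigma> (Centre s))) =
    star_weight (\<sigma> (Centre s) \<noteq> home s)
      (if \<sigma> (Centre s) \<noteq> home s then away n s \<sigma> + 1 else away n s \<sigma> - 1)"
proof -
  let ?S = "{i. i < n \<and> \<sigma> (Leaf s i) \<noteq> home s}"
  have "{i. i < n \<and> (\<sigma>(Leaf s j := \<sigma> (Centre s))) (Leaf s i) \<noteq> home s} =
      (if \<sigma> (Centre s) \<noteq> home s then insert j ?S else ?S - {j})"
    using assms by auto
  \<comment> \<open>A discordant leaf is away exactly when its centre is home, so the insertion or
    deletion really changes the count by one.\<close>
  moreover have "j \<in> ?S \<longleftrightarrow> \<sigma> (Centre s) = home s"
    using assms by (cases "\<sigma> (Leaf s j)"; cases "\<sigma> (Centre s)"; cases "home s") auto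
  moreover have "finite ?S" by simp
  ultimately show ?thesis
    unfolding star_potential_def away_def by (simp add: card_insert_if del: fun_upd_apply) simp
qed

text \<open>Evaluated vertex by vertex, the sum becomes the three summands of
  \<open>star_weight_drift\<close>, with \<open>K\<close> and \<open>K'\<close> the discordant
  leaves of the two stars.\<close>

lemma sum_push_drift_star_potential:
  assumes "5 * away n s \<sigma> + 16 \<le> n"
  shows "(\<Sum>v\<in>discordant_vertices (double_star_edges n) \<sigma>.
    push_drift (double_star_edges n) \<sigma> (star_potential n s) v) \<le> 1 / 4"
proof -
  let ?E = "double_star_edges n"
  let ?h = "push_drift ?E \<sigma> (star_potential n s)"
  define b where "b \<longleftrightarrow> \<sigma> (Centre s) \<noteq> home s"
  define a where "a = away n s \<sigma>"
  define K where "K = {j. j < n \<and> \<sigma> (Leaf s j) \<noteq> \<sigma> (Centre s)}"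
  define K' where "K' = {j. j < n \<and> \<sigma> (Leaf (other s) j) \<noteq> \<sigma> (Centre (other s))}"
  define m :: nat where "m = (if \<sigma> (Centre (other s)) \<noteq> \<sigma> (Centre s) then 1 else 0)"
  have fin: "finite K" "finite K'" by (simp_all add: K_def K'_def)
  have k: "card K = (if b then n - a else a)"
    by (simp add: K_def card_discordant_leaves a_def b_def)
  have "m \<le> 1" by (simp add: m_def)
  note drift = star_weight_drift [OF k this, of "card K'", OF assms [folded a_def]]
  have F: "star_potential n s \<sigma> = star_weight b a"
    by (simp add: star_potential_def a_def b_def)
  have "sum ?h (discordant_vertices ?E \<sigma>) = sum ?h (double_star_vertices n)"
    using discordant_subset_Union(1) [of ?E \<sigma>] Union_double_star_edges [of n]
    by (intro sum.mono_neutral_left finite_double_star_vertices)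
      (auto simp: discordant_vertices_iff push_drift_def)
  also have "\<dots> = ?h (Centre s) + (\<Sum>j<n. ?h (Leaf s j)) + ?h (Centre (other s)) +
      (\<Sum>j<n. ?h (Leaf (other s) j))"
    by (rule sum_double_star_vertices)
  \<comment> \<open>A leaf of the other star can recolour only the other centre, which this
    potential does not see.\<close>
  also have "(\<Sum>j<n. ?h (Leaf (other s) j)) = 0"
    by (intro sum.neutral)
      (auto simp: push_drift_def discordant_neighbours_Leaf star_potential_upd_other)
  also have "(\<Sum>j<n. ?h (Leaf s j)) = card K * (star_weight (\<not> b) a - star_weight b a)"
  proof -
    have "(\<Sum>j<n. ?h (Leaf s j)) = (\<Sum>j<n. if j \<in> K then star_weight (\<not> b) a - star_weight b a else 0)"
      by (intro sum.cong refl)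
        (auto simp: push_drift_def discordant_neighbours_Leaf star_potential_upd_Centre F a_def b_def K_def)
    also have "\<dots> = (\<Sum>j\<in>K. star_weight (\<not> b) a - star_weight b a)"
      by (rule sum.mono_neutral_cong_right) (auto simp: K_def)
    finally show ?thesis by simp
  qed
  \<comment> \<open>Pushing onto the other centre leaves this potential unchanged; that choice shows
    up only as \<open>m\<close> in the denominator.\<close>
  also have "?h (Centre s) =
      real (card K) * (star_weight b (if b then a + 1 else a - 1) - star_weight b a) / real (card K + m)"
  proof -
    have N: "discordant_neighbours ?E \<sigma> (Centre s) =
        Leaf s ` K \<union> (if m = 1 then {Centre (other s)} else {})"
      by (simp add: discordant_neighbours_Centre K_def m_def)
    have "card (discordant_neighbours ?E \<sigma> (Centre s)) = card K + m"
      unfolding N using fin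
      by (subst card_Un_disjoint) (auto simp: card_image inj_on_def m_def)
    moreover have "(\<Sum>u\<in>discordant_neighbours ?E \<sigma> (Centre s).
        star_potential n s (\<sigma>(u := \<sigma> (Centre s))) - star_potential n s \<sigma>) =
        (\<Sum>u\<in>Leaf s ` K. star_potential n s (\<sigma>(u := \<sigma> (Centre s))) - star_potential n s \<sigma>)"
      unfolding N using fin
      by (intro sum.mono_neutral_right) (auto simp: star_potential_upd_other)
    moreover have "\<dots> = (\<Sum>j\<in>K. star_weight b (if b then a + 1 else a - 1) - star_weight b a)"
      by (subst sum.reindex)
        (auto simp: inj_on_def F a_def b_def K_def star_potential_upd_Leaf intro!: sum.cong)
    ultimately show ?thesis by (simp add: push_drift_def)
  qed
  \<comment> \<open>Here the pushes onto the other star's own leaves contribute nothing, and only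
    the push onto this centre counts.\<close>
  also have "?h (Centre (other s)) =
      real m * (star_weight (\<not> b) a - star_weight b a) / real (card K' + m)"
  proof -
    have oo: "other (other s) = s" by (cases s) auto
    have N: "discordant_neighbours ?E \<sigma> (Centre (other s)) =
        Leaf (other s) ` K' \<union> (if m = 1 then {Centre s} else {})"
      by (auto simp add: discordant_neighbours_Centre K'_def m_def oo)
    have "card (discordant_neighbours ?E \<sigma> (Centre (other s))) = card K' + m"
      unfolding N using fin
      by (subst card_Un_disjoint) (auto simp: card_image inj_on_def m_def)
    moreover have "(\<Sum>u\<in>discordant_neighbours ?E \<sigma> (Centre (other s)).
        star_potential n s (\<sigma>(u := \<sigma> (Centre (other s)))) - star_potential n s \<sigma>) =
        (\<Sum>u\<in>(if m = 1 then {Centre s} else {}).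
          star_potential n s (\<sigma>(u := \<sigma> (Centre (other s)))) - star_potential n s \<sigma>)"
      unfolding N using fin
      by (intro sum.mono_neutral_right) (auto simp: star_potential_upd_other)
    moreover have "\<dots> = real m * (star_weight (\<not> b) a - star_weight b a)"
      by (auto simp: m_def F a_def b_def star_potential_upd_Centre)
    ultimately show ?thesis by (simp add: push_drift_def)
  qed
  finally show ?thesis using drift by linarith
qed

section \<open>The total potential and the convergence time\<close>

definition potential :: "nat \<Rightarrow> vertex colouring \<Rightarrow> real" where
  "potential n \<sigma> = star_potential n S1 \<sigma> + star_potential n S2 \<sigma>"

lemma star_potential_ge: "star_potential n s \<sigma> \<ge> 4 ^ away n s \<sigma>"
  by (simp add: star_potential_def star_weight_def)

lemma potential_ge: "potential n \<sigma> \<ge> 4 ^ away n s \<sigma>"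
proof -
  have "0 \<le> star_potential n r \<sigma>" for r
    by (rule order_trans [OF _ star_potential_ge]) simp
  from this [of S1] this [of S2] star_potential_ge [of n s \<sigma>] show ?thesis
    by (cases s) (auto simp: potential_def)
qed

text \<open>Each star contributes at most \<open>1 / 4\<close> to the summed drift, and the sum is
  divided by at least one discordant vertex. Without discordant vertices the chain stays
  put.\<close>

lemma expectation_potential_le:
  assumes "\<And>s. 5 * away n s \<sigma> + 16 \<le> n"
  shows "measure_pmf.expectation (push_step (double_star_edges n) \<sigma>) (potential n) \<le>
    potential n \<sigma> + 1 / 2"
proof (cases "discordant_vertices (double_star_edges n) \<sigma> = {}")
  case True
  then show ?thesis by (simp add: push_step_def)
next
  case False
  let ?E = "double_star_edges n"
  let ?D = "discordant_vertices ?E \<sigma>"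
  have fin: "finite (\<Union>?E)"
    by (rule finite_subset [OF Union_double_star_edges finite_double_star_vertices])
  have "(\<Sum>v\<in>?D. push_drift ?E \<sigma> (potential n) v) \<le> 1 / 4 + 1 / 4"
    unfolding potential_def [abs_def] push_drift_add sum.distrib
    by (intro add_mono sum_push_drift_star_potential assms)
  moreover have "real (card ?D) \<ge> 1"
    using False finite_subset [OF discordant_subset_Union(1) fin]
    by (simp add: Suc_le_eq card_gt_0_iff)
  ultimately have "(\<Sum>v\<in>?D. push_drift ?E \<sigma> (potential n) v) / card ?D \<le> 1 / 2"
    by (simp add: divide_simps)
  then show ?thesis
    unfolding expectation_push_step [OF fin False] by simp
qed

text \<open>The home colours of the two stars differ, so any consensus colour is foreign to one of
  them.\<close>

lemma monochromatic_away:
  assumes "monochromatic (double_star_vertices n) \<sigma>"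
  shows "\<exists>s. away n s \<sigma> = n"
proof -
  from assms obtain c where c: "\<forall>v\<in>double_star_vertices n. \<sigma> v = c"
    by (auto simp: monochromatic_def)
  obtain s where "home s \<noteq> c" by (cases c) (metis home.simps colour.distinct)+
  have "\<sigma> (Leaf s j) = c" if "j < n" for j
    using c that by (cases s) (auto simp: double_star_vertices_def star_vertices_def)
  then have "{j. j < n \<and> \<sigma> (Leaf s j) \<noteq> home s} = {..<n}"
    using \<open>home s \<noteq> c\<close> by auto
  then have "away n s \<sigma> = n" by (simp add: away_def)
  then show ?thesis ..
qed

lemma potential_initial_colouring: "potential n (initial_colouring n) = 2"
proof -
  have "star_potential n s (initial_colouring n) = 1" for s
  proof -
    have "\<forall>j<n. initial_colouring n (Leaf s j) = home s"
      by (cases s) (auto simp: initial_colouring_def star_vertices_def)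
    moreover have "initial_colouring n (Centre s) = home s"
      by (cases s) (auto simp: initial_colouring_def star_vertices_def)
    ultimately show ?thesis
      by (simp add: star_potential_def away_def star_weight_def cong: conj_cong)
  qed
  then show ?thesis by (simp add: potential_def)
qed

text \<open>The horizon \<open>t = 4 ^ A\<close> also serves as the threshold for the potential.
  Start value 2 and drift \<open>1 / 2\<close> per step then leave a constant survival probability
  at time \<open>t\<close>.\<close>

lemma expected_convergence_time_double_star:
  assumes "n \<ge> 26"
  shows "expected_convergence_time (double_star_vertices n) (double_star_edges n) (initial_colouring n)
    \<ge> ennreal (4 ^ ((n - 11) div 5) / 4)"
proof -
  let ?V = "double_star_vertices n" and ?E = "double_star_edges n" and ?x = "initial_colouring n"
  \<comment> \<open>Potential below \<open>4 ^ A\<close> forces \<open>away < A\<close>, hence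
    \<open>5 * away + 16 \<le> 5 * A + 11 \<le> n\<close>, as the drift bound requires.\<close>
  define A where "A = (n - 11) div 5"
  define t :: nat where "t = 4 ^ A"
  have "A \<ge> 3" using assms by (simp add: A_def)
  then have "(4::nat) ^ 3 \<le> t" unfolding t_def by (intro power_increasing) auto
  then have t: "real t \<ge> 8" by simp
  have fin: "finite (set_pmf (push_step ?E \<sigma>))" for \<sigma>
    by (rule finite_set_pmf_push_step, rule finite_subset [OF Union_double_star_edges finite_double_star_vertices])
  have "(\<Sum>l\<in>surviving_paths (push_step ?E) (monochromatic ?V) t ?x. path_weight (push_step ?E) t l)
      \<ge> 1 - (potential n ?x + 1 / 2 * t) / t"
  proof (rule sum_path_weight_ge [OF fin])
    show "0 \<le> potential n \<sigma>" for \<sigma>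
      by (rule order_trans [OF _ potential_ge [of n S1]]) simp
    show "real t \<le> potential n \<sigma>" if "monochromatic ?V \<sigma>" for \<sigma>
    proof -
      obtain s where "away n s \<sigma> = n" using monochromatic_away \<open>monochromatic ?V \<sigma>\<close> by blast
      then have "4 ^ n \<le> potential n \<sigma>" using potential_ge [of n s \<sigma>] by simp
      moreover have "real t \<le> 4 ^ n"
        unfolding t_def A_def of_nat_power of_nat_numeral by (intro power_increasing) auto
      ultimately show ?thesis by (rule order_trans [rotated])
    qed
    show "measure_pmf.expectation (push_step ?E \<sigma>) (potential n) \<le> potential n \<sigma> + 1 / 2"
      if "potential n \<sigma> < real t" for \<sigma>
    proof (rule expectation_potential_le)
      fix s
      have "(4::real) ^ away n s \<sigma> < 4 ^ A"
        by (rule le_less_trans [OF potential_ge]) (use that in \<open>simp add: t_def\<close>)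
      then have "away n s \<sigma> < A" by (rule power_less_imp_less_exp [rotated]) simp
      then show "5 * away n s \<sigma> + 16 \<le> n" using assms unfolding A_def by presburger
    qed
  qed (use t in auto)
  \<comment> \<open>The left side is \<open>1 / 2 - 2 / t\<close>, so \<open>t \<ge> 8\<close> is
    what gives \<open>1 / 4\<close>.\<close>
  moreover have "1 - (potential n ?x + 1 / 2 * t) / t \<ge> 1 / 4"
    using t by (simp add: potential_initial_colouring field_simps)
  ultimately have "ennreal (1 / 4) \<le>
      ennreal (\<Sum>l\<in>surviving_paths (push_step ?E) (monochromatic ?V) t ?x. path_weight (push_step ?E) t l)"
    by (intro ennreal_leI) linarith
  also have "\<dots> \<le> emeasure (markov_paths (push_step ?E) ?x) {\<omega>. \<forall>i\<le>t. \<not> monochromatic ?V (\<omega> i)}"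
    by (rule emeasure_survival_ge [OF fin])
  finally have "of_nat t * ennreal (1 / 4) \<le>
      of_nat t * emeasure (markov_paths (push_step ?E) ?x) {\<omega>. \<forall>i\<le>t. \<not> monochromatic ?V (\<omega> i)}"
    by (rule mult_left_mono) simp
  also have "\<dots> \<le> expected_convergence_time ?V ?E ?x"
    by (rule expected_convergence_time_ge_survival)
  finally have "of_nat t * ennreal (1 / 4) \<le> expected_convergence_time ?V ?E ?x" .
  moreover have "of_nat t * ennreal (1 / 4) = ennreal (4 ^ A / 4)"
    unfolding ennreal_of_nat_eq_real_of_nat by (subst ennreal_mult [symmetric]) (auto simp: t_def)
  ultimately show ?thesis by (simp add: A_def)
qed

theorem theorem5:
  shows "\<exists>c > 0. \<forall>\<^sub>F n in sequentially.
    expected_convergence_time (double_star_vertices n) (double_star_edges n) (initial_colouring n)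
      \<ge> ennreal (c * 2 powr (2 * real n / 5))"
proof (intro exI conjI eventually_sequentiallyI)
  \<comment> \<open>Rounding in \<open>A\<close> gives \<open>n \<le> 5 * A + 15\<close>, which
    costs a factor \<open>2 ^ 6 = 64\<close>; the survival probability \<open>1 / 4\<close> costs
    another 4.\<close>
  show "(1 / 256 :: real) > 0" by simp
  fix n :: nat
  assume n: "26 \<le> n"
  define A where "A = (n - 11) div 5"
  have "2 powr (2 * real n / 5) \<le> 2 powr (2 * real A + 6)"
  proof (rule powr_mono)
    have "n \<le> 5 * A + 15" using n unfolding A_def by presburger
    then have "real n \<le> 5 * real A + 15" by linarith
    then show "2 * real n / 5 \<le> 2 * real A + 6" by simp
  qed simp
  also have "\<dots> = 2 powr real (2 * A + 6)" by simp
  also have "\<dots> = 2 ^ (2 * A + 6)" by (rule powr_realpow) simp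
  also have "\<dots> = 64 * 4 ^ A" by (simp add: power_add power_mult)
  finally have "1 / 256 * 2 powr (2 * real n / 5) \<le> 4 ^ A / 4" by simp
  then show "ennreal (1 / 256 * 2 powr (2 * real n / 5)) \<le>
      expected_convergence_time (double_star_vertices n) (double_star_edges n) (initial_colouring n)"
    using expected_convergence_time_double_star [OF n] unfolding A_def
    by (meson ennreal_leI order_trans)
qed

end
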